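(* Let $(X_t;\ t\geq 0)$ be a right-continuous IDT process (so that, in particular, the law of $X_1$ is infinitely divisible), and let $(\tilde{X}_t;\ t\geq 0)$ be the unique (in law) Lévy process such that $X_1\overset{(d)}{=}\tilde{X}_1$. Then $(X_t;\ t\geq 0)$ and $(\tilde{X}_t;\ t\geq 0)$ have the same one-dimensional marginals, i.e. for every fixed $t\geq 0$, $$X_t\overset{(d)}{=}\tilde{X}_t.$$
   Context: A real-valued stochastic process $(X_t;\ t\geq 0)$ is called an IDT process (infinitely divisible with respect to time) if for every integer $n\geq 1$, $(X_{nt};\ t\geq 0)\overset{(d)}{=}(X^{(1)}_t+\dots+X^{(n)}_t;\ t\geq 0)$, where $X^{(1)},\dots,X^{(n)}$ are independent copies of $X$ and $\overset{(d)}{=}$ denotes equality in law (for processes: equality of all finite-dimensional distributions). Right-continuous means that the sample paths $t\mapsto X_t$ are right-continuous on $[0,\infty)$. *)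

theory Defs
  imports "HOL-Probability.Probability"
begin

text \<open>Processes are indexed by \<open>real\<close>; only the values at times \<open>t \<ge> 0\<close> are ever constrained.\<close>

definition real_process :: "'a measure \<Rightarrow> (real \<Rightarrow> 'a \<Rightarrow> real) \<Rightarrow> bool" where
  "real_process M X \<longleftrightarrow> prob_space M \<and> (\<forall>t\<ge>0. X t \<in> borel_measurable M)"

definition fin_dim_distr ::
  "'a measure \<Rightarrow> (real \<Rightarrow> 'a \<Rightarrow> real) \<Rightarrow> real set \<Rightarrow> (real \<Rightarrow> real) measure" where
  "fin_dim_distr M X J = distr M (Pi\<^sub>M J (\<lambda>_. borel)) (\<lambda>\<omega>. \<lambda>t\<in>J. X t \<omega>)"

definition eq_in_law ::
  "'a measure \<Rightarrow> (real \<Rightarrow> 'a \<Rightarrow> real) \<Rightarrow> 'b measure \<Rightarrow> (real \<Rightarrow> 'b \<Rightarrow> real) \<Rightarrow> bool" where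
  "eq_in_law M X N Y \<longleftrightarrow>
     (\<forall>J. finite J \<and> J \<subseteq> {0..} \<longrightarrow> fin_dim_distr M X J = fin_dim_distr N Y J)"

text \<open>The \<open>n\<close> independent copies of \<open>X\<close> are realised on the \<open>n\<close>-fold product space
  as \<open>X t (\<omega> i)\<close> for \<open>i < n\<close>. The law of their sum does not depend on how the
  independent copies are realised.\<close>

definition IDT_process :: "'a measure \<Rightarrow> (real \<Rightarrow> 'a \<Rightarrow> real) \<Rightarrow> bool" where
  "IDT_process M X \<longleftrightarrow> real_process M X \<and>
     (\<forall>n\<ge>1::nat. eq_in_law
        M (\<lambda>t \<omega>. X (real n * t) \<omega>)
        (Pi\<^sub>M {..<n} (\<lambda>_. M)) (\<lambda>t \<omega>. \<Sum>i<n. X t (\<omega> i)))"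

definition right_continuous_paths :: "'a measure \<Rightarrow> (real \<Rightarrow> 'a \<Rightarrow> real) \<Rightarrow> bool" where
  "right_continuous_paths M X \<longleftrightarrow>
     (\<forall>\<omega>\<in>space M. \<forall>t\<ge>0. continuous (at_right t) (\<lambda>s. X s \<omega>))"

definition infinitely_divisible :: "real measure \<Rightarrow> bool" where
  "infinitely_divisible \<mu> \<longleftrightarrow> real_distribution \<mu> \<and>
     (\<forall>n\<ge>1::nat. \<exists>\<nu>. real_distribution \<nu> \<and>
        \<mu> = distr (Pi\<^sub>M {..<n} (\<lambda>_. \<nu>)) borel (\<lambda>x. \<Sum>i<n. x i))"

definition independent_increments :: "'a measure \<Rightarrow> (real \<Rightarrow> 'a \<Rightarrow> real) \<Rightarrow> bool" where
  "independent_increments M X \<longleftrightarrow>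
     (\<forall>(n::nat) t. 0 \<le> t 0 \<and> (\<forall>i<n. t i < t (Suc i)) \<longrightarrow>
        prob_space.indep_vars M (\<lambda>_. borel) (\<lambda>i \<omega>. X (t (Suc i)) \<omega> - X (t i) \<omega>) {..<n})"

definition stationary_increments :: "'a measure \<Rightarrow> (real \<Rightarrow> 'a \<Rightarrow> real) \<Rightarrow> bool" where
  "stationary_increments M X \<longleftrightarrow>
     (\<forall>s\<ge>0. \<forall>h\<ge>0. distr M borel (\<lambda>\<omega>. X (s + h) \<omega> - X s \<omega>)
                  = distr M borel (\<lambda>\<omega>. X h \<omega> - X 0 \<omega>))"

definition stochastically_continuous :: "'a measure \<Rightarrow> (real \<Rightarrow> 'a \<Rightarrow> real) \<Rightarrow> bool" where
  "stochastically_continuous M X \<longleftrightarrow>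
     (\<forall>t\<ge>0. \<forall>\<epsilon>>0.
        ((\<lambda>s. measure M {\<omega> \<in> space M. \<bar>X s \<omega> - X t \<omega>\<bar> > \<epsilon>}) \<longlongrightarrow> 0) (at t within {0..}))"

definition cadlag :: "(real \<Rightarrow> real) \<Rightarrow> bool" where
  "cadlag f \<longleftrightarrow>
     (\<forall>t\<ge>0. continuous (at_right t) f) \<and> (\<forall>t>0. \<exists>l. (f \<longlongrightarrow> l) (at_left t))"

definition Levy_process :: "'a measure \<Rightarrow> (real \<Rightarrow> 'a \<Rightarrow> real) \<Rightarrow> bool" where
  "Levy_process M X \<longleftrightarrow> real_process M X \<and>
     (AE \<omega> in M. X 0 \<omega> = 0) \<and>
     independent_increments M X \<and>
     stationary_increments M X \<and>
     stochastically_continuous M X \<and>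
     (AE \<omega> in M. cadlag (\<lambda>t. X t \<omega>))"

end

theory Submission imports Defs
begin

text \<open>
  The characteristic functions \<open>\<phi> t\<close> of \<open>X t\<close>, and likewise those of \<open>Y t\<close>, satisfy
  \<open>\<phi> (n t) = (\<phi> t)^n\<close> and are right-continuous in \<open>t\<close>. Hence \<open>\<phi> 0\<close> is idempotent and continuous, so it is identically 1,
  and \<open>\<phi> (1/n) u \<longlonglongrightarrow> 1\<close> shows that \<open>\<phi> 1\<close> has no zeros. A continuous \<open>n\<close>-th root of
  \<open>\<phi> 1\<close> with value 1 at the origin is then unique, so \<open>\<phi> 1\<close> determines \<open>\<phi> (1/n)\<close>, thus
  \<open>\<phi>\<close> at rational times and, by right-continuity, at all times.
\<close>

subsection \<open>Right-continuous families with the scaling property\<close>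

text \<open>Isolates what the marginal characteristic functions of \<open>X\<close> and
  \<open>Y\<close> have in common, so that the comparison needs neither paths nor
  increments.\<close>

locale scaling_family =
  fixes \<phi> :: "real \<Rightarrow> real \<Rightarrow> complex"
  assumes scale: "\<And>t n u. t \<ge> 0 \<Longrightarrow> n \<ge> 1 \<Longrightarrow> \<phi> (real n * t) u = \<phi> t u ^ n"
    and at_origin: "\<And>t. t \<ge> 0 \<Longrightarrow> \<phi> t 0 = 1"
    and continuous: "\<And>t. t \<ge> 0 \<Longrightarrow> continuous_on UNIV (\<phi> t)"
    and right_cont: "\<And>t u. t \<ge> 0 \<Longrightarrow> ((\<lambda>s. \<phi> s u) \<longlongrightarrow> \<phi> t u) (at_right t)"
begin

lemma time_zero: "\<phi> 0 u = 1"
proof -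
  have "\<phi> 0 v \<in> {0, 1}" for v
  proof -
    \<comment> \<open>Time 0 is fixed by scaling, so \<open>scale\<close> with \<open>n = 2\<close>
      gives idempotence.\<close>
    have "\<phi> 0 v ^ 2 = \<phi> 0 v"
      by (rule trans[OF scale[symmetric, of 0 2 v]]) simp_all
    then show ?thesis
      by (simp add: power2_eq_square)
  qed
  then have "finite (range (\<phi> 0))"
    by (rule finite_subset[of _ "{0, 1}", OF image_subsetI]) simp
  then have "\<phi> 0 constant_on UNIV"
    using continuous[of 0] by (intro continuous_finite_range_constant) auto
  then show ?thesis
    using at_origin[of 0] by (auto simp: constant_on_def)
qed

lemma time_inverse_power:
  assumes "n \<ge> 1"
  shows "\<phi> (1 / real n) u ^ n = \<phi> 1 u"
  using scale[of "1 / real n" n u] assms by simp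

text \<open>A zero of \<open>\<phi> 1\<close> at \<open>u\<close> would be a zero of
  \<open>\<phi> (1 / real n)\<close> at \<open>u\<close> for all \<open>n \<ge> 1\<close>, against
  right-continuity at time 0, where the value is 1.\<close>

lemma time_one_nonzero: "\<phi> 1 u \<noteq> 0"
proof -
  have "((\<lambda>s. \<phi> s u) \<longlongrightarrow> 1) (at_right 0)"
    using right_cont[of 0 u] time_zero by simp
  then have "\<forall>\<^sub>F s in at_right 0. \<phi> s u \<noteq> 0"
    by (rule tendsto_imp_eventually_ne) simp
  then obtain b where b: "b > 0" "\<And>s. 0 < s \<Longrightarrow> s < b \<Longrightarrow> \<phi> s u \<noteq> 0"
    by (auto simp: eventually_at_right_field)
  obtain n where n: "n \<noteq> 0" "inverse (real n) < b"
    using real_arch_invD[OF b(1)] by blast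
  then have "\<phi> (1 / real n) u \<noteq> 0"
    by (intro b) (auto simp: field_simps)
  then show ?thesis
    using time_inverse_power[of n u] n by (metis One_nat_def Suc_leI neq0_conv power_eq_0_iff)
qed

lemma time_inverse_nonzero: "n \<ge> 1 \<Longrightarrow> \<phi> (1 / real n) u \<noteq> 0"
  using time_inverse_power[of n u] time_one_nonzero[of u] by (auto simp: power_0_left)

end

lemma scaling_family_unique:
  assumes "scaling_family \<phi>" "scaling_family \<psi>" and one: "\<phi> 1 = \<psi> 1" and "t \<ge> 0"
  shows "\<phi> t = \<psi> t"
proof
  fix u
  interpret \<phi>: scaling_family \<phi> by fact
  interpret \<psi>: scaling_family \<psi> by fact
  have inv: "\<phi> (1 / real n) v = \<psi> (1 / real n) v" if n: "n \<ge> 1" for n v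
  proof -
    \<comment> \<open>The quotient of two \<open>n\<close>-th roots of the same nonvanishing
      function takes values in the finite set of \<open>n\<close>-th roots of unity. Being
      continuous on the connected line, it is constant, and its value at 0 is 1.\<close>
    let ?q = "\<lambda>v. \<phi> (1 / real n) v / \<psi> (1 / real n) v"
    have root: "?q v ^ n = 1" for v
      using n \<phi>.time_one_nonzero[of v]
      by (simp add: power_divide \<phi>.time_inverse_power \<psi>.time_inverse_power one)
    have "finite (range ?q)"
      by (rule finite_subset[OF _ finite_roots_unity[of n]]) (use root n in auto)
    moreover have "continuous_on UNIV ?q"
      using n \<psi>.time_inverse_nonzero
      by (intro continuous_on_divide \<phi>.continuous \<psi>.continuous) auto
    ultimately have "?q constant_on UNIV"
      by (intro continuous_finite_range_constant) auto
    moreover have "?q 0 = 1"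
      using n by (simp add: \<phi>.at_origin \<psi>.at_origin)
    ultimately have "?q v = 1"
      unfolding constant_on_def by (metis UNIV_I)
    then show ?thesis
      using \<psi>.time_inverse_nonzero[OF n, of v] by simp
  qed
  have rat: "\<phi> q u = \<psi> q u" if q: "q \<in> \<rat>" "q > 0" for q
  proof -
    obtain m n :: nat where mn: "n \<noteq> 0" "q = real m / real n"
      using Rats_abs_nat_div_natE[OF q(1)] q(2) by (metis abs_of_pos)
    then have m: "m \<ge> 1" and q_eq: "q = real m * (1 / real n)"
      using q(2) by (auto simp: Suc_le_eq intro!: Nat.gr0I)
    show ?thesis
      unfolding q_eq using m mn(1) \<phi>.scale[of "1 / real n" m u] \<psi>.scale[of "1 / real n" m u]
      by (simp add: inv)
  qed
  \<comment> \<open>Approximation strictly from the right: this matches the filter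
    \<open>at_right t\<close> and keeps the rationals positive even when
    \<open>t = 0\<close>.\<close>
  have "\<exists>q\<in>\<rat>. t < q \<and> q < t + inverse (real (Suc k))" for k
    by (rule Rats_dense_in_real) simp
  then obtain q where q: "\<And>k. q k \<in> \<rat>" "\<And>k. t < q k"
      "\<And>k. q k < t + inverse (real (Suc k))"
    by metis
  have q_lim: "q \<longlonglongrightarrow> t"
  proof (rule tendsto_sandwich[where f="\<lambda>_. t"])
    show "(\<lambda>k. t + inverse (real (Suc k))) \<longlonglongrightarrow> t"
      using tendsto_add[OF tendsto_const LIMSEQ_inverse_real_of_nat] by simp
  qed (rule always_eventually allI less_imp_le q tendsto_const)+
  have "q k \<in> {t<..} \<and> q k \<noteq> t" for k
    using q(2)[of k] by simp
  then have q_right: "filterlim q (at_right t) sequentially"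
    unfolding filterlim_at by (intro conjI always_eventually allI q_lim) auto
  have "(\<lambda>k. \<phi> (q k) u) \<longlonglongrightarrow> \<phi> t u" "(\<lambda>k. \<psi> (q k) u) \<longlonglongrightarrow> \<psi> t u"
    using filterlim_compose[OF \<phi>.right_cont[OF \<open>t \<ge> 0\<close>] q_right]
      filterlim_compose[OF \<psi>.right_cont[OF \<open>t \<ge> 0\<close>] q_right] .
  moreover have "\<phi> (q k) u = \<psi> (q k) u" for k
    using rat q(1) order_le_less_trans[OF \<open>t \<ge> 0\<close> q(2)] by blast
  ultimately show "\<phi> t u = \<psi> t u"
    by (simp add: LIMSEQ_unique[of "\<lambda>k. \<psi> (q k) u"])
qed

subsection \<open>Characteristic functions of the marginals\<close>

text \<open>Dominated convergence along sequences decreasing to \<open>t\<close> from the right,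
  with bound 1 since \<open>iexp\<close> has modulus 1. Path continuity is asked only almost
  everywhere because a Levy process is cadlag only almost surely.\<close>

lemma char_marginal_right_cont:
  fixes Z :: "real \<Rightarrow> 'a \<Rightarrow> real"
  assumes "real_process M Z" and "t \<ge> 0"
    and rc: "AE \<omega> in M. continuous (at_right t) (\<lambda>s. Z s \<omega>)"
  shows "((\<lambda>s. char (distr M borel (Z s)) u) \<longlongrightarrow> char (distr M borel (Z t)) u) (at_right t)"
  unfolding tendsto_at_iff_sequentially comp_def
proof (intro allI impI)
  fix S :: "nat \<Rightarrow> real"
  assume S: "\<forall>i. S i \<in> {t<..} - {t}" and lim: "S \<longlonglongrightarrow> t"
  interpret prob_space M
    using assms(1) by (simp add: real_process_def)
  have meas: "Z s \<in> borel_measurable M" if "s \<ge> 0" for s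
    using assms(1) that by (simp add: real_process_def)
  have S_pos: "S i \<ge> 0" for i
    using S \<open>t \<ge> 0\<close> by (metis DiffD1 greaterThan_iff less_imp_le order.trans)
  have [measurable]: "Z t \<in> borel_measurable M" "Z (S i) \<in> borel_measurable M" for i
    using meas \<open>t \<ge> 0\<close> S_pos by auto
  have "S i \<in> {t<..} \<and> S i \<noteq> t" for i
    using S by blast
  then have S_right: "filterlim S (at_right t) sequentially"
    unfolding filterlim_at by (intro conjI always_eventually allI lim) auto
  have "(\<lambda>i. CLINT \<omega>|M. iexp (u * Z (S i) \<omega>)) \<longlonglongrightarrow> (CLINT \<omega>|M. iexp (u * Z t \<omega>))"
  proof (rule integral_dominated_convergence[where w="\<lambda>_. 1"])
    show "AE \<omega> in M. (\<lambda>i. iexp (u * Z (S i) \<omega>)) \<longlonglongrightarrow> iexp (u * Z t \<omega>)"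
      using rc
    proof eventually_elim
      case (elim \<omega>)
      then have "(\<lambda>i. Z (S i) \<omega>) \<longlonglongrightarrow> Z t \<omega>"
        by (intro filterlim_compose[OF _ S_right]) (simp add: continuous_within)
      then show ?case
        by (intro tendsto_intros)
    qed
  qed auto
  then show "(\<lambda>i. char (distr M borel (Z (S i))) u) \<longlonglongrightarrow> char (distr M borel (Z t)) u"
    by (simp add: char_def integral_distr)
qed

lemma scaling_family_char_marginal:
  fixes Z :: "real \<Rightarrow> 'a \<Rightarrow> real"
  assumes proc: "real_process M Z"
    and rc: "\<And>t. t \<ge> 0 \<Longrightarrow> AE \<omega> in M. continuous (at_right t) (\<lambda>s. Z s \<omega>)"
    and "\<And>t n u. t \<ge> 0 \<Longrightarrow> n \<ge> 1 \<Longrightarrow>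
           char (distr M borel (Z (real n * t))) u = char (distr M borel (Z t)) u ^ n"
  shows "scaling_family (\<lambda>t. char (distr M borel (Z t)))"
proof
  fix t :: real assume t: "t \<ge> 0"
  have rd: "real_distribution (distr M borel (Z t))"
    using proc t by (auto simp: real_process_def intro: prob_space.real_distribution_distr)
  show "char (distr M borel (Z t)) 0 = 1"
    by (rule real_distribution.char_zero[OF rd])
  show "continuous_on UNIV (char (distr M borel (Z t)))"
    by (simp add: continuous_at_imp_continuous_on real_distribution.isCont_char[OF rd])
next
  fix t u :: real assume "t \<ge> 0"
  then show "((\<lambda>s. char (distr M borel (Z s)) u) \<longlongrightarrow> char (distr M borel (Z t)) u) (at_right t)"
    by (intro char_marginal_right_cont proc rc)
qed (use assms(3) in auto)

section \<open>Sums of independent copies and powers of characteristic functions\<close>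

lemma distr_PiM_sum:
  fixes n :: nat
  assumes "prob_space M" and [measurable]: "f \<in> borel_measurable M"
  shows "distr (Pi\<^sub>M {..<n} (\<lambda>_. M)) borel (\<lambda>\<omega>. \<Sum>i<n. f (\<omega> i) :: real)
       = distr (Pi\<^sub>M {..<n} (\<lambda>_. distr M borel f)) borel (\<lambda>x. \<Sum>i<n. x i)"
proof -
  \<comment> \<open>The rule for images of product measures wants probability spaces as targets,
    which \<open>borel\<close> is not. Only the sigma-algebra of a target matters to
    \<open>distr\<close>, so the law of \<open>f\<close> stands in for \<open>borel\<close> and is
    exchanged back afterwards.\<close>
  have "Pi\<^sub>M {..<n} (\<lambda>_. distr M borel f)
      = Pi\<^sub>M {..<n} (\<lambda>_. distr M (distr M borel f) f)"
    by (intro PiM_cong distr_cong) auto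
  also have "\<dots> = distr (Pi\<^sub>M {..<n} (\<lambda>_. M)) (Pi\<^sub>M {..<n} (\<lambda>_. distr M borel f))
      (compose {..<n} f)"
    using assms(1)
    by (intro distr_PiM_finite_prob_space'[symmetric]) (auto intro: prob_space.prob_space_distr)
  also have "\<dots> = distr (Pi\<^sub>M {..<n} (\<lambda>_. M)) (Pi\<^sub>M {..<n} (\<lambda>_. borel)) (compose {..<n} f)"
    by (intro distr_cong sets_PiM_cong) auto
  finally have "Pi\<^sub>M {..<n} (\<lambda>_. distr M borel f)
      = distr (Pi\<^sub>M {..<n} (\<lambda>_. M)) (Pi\<^sub>M {..<n} (\<lambda>_. borel)) (compose {..<n} f)" .
  moreover have "compose {..<n} f \<in> measurable (Pi\<^sub>M {..<n} (\<lambda>_. M)) (Pi\<^sub>M {..<n} (\<lambda>_. borel))"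
    unfolding compose_def by (intro measurable_restrict) auto
  ultimately show ?thesis
    by (simp add: distr_distr comp_def compose_def)
qed

text \<open>Under the product measure the coordinates are independent with law \<open>\<nu>\<close>,
  so the characteristic function of their sum is a product of equal factors.\<close>

lemma char_convolution_power:
  fixes n :: nat
  assumes "real_distribution \<nu>" and "n \<ge> 1"
  shows "char (distr (Pi\<^sub>M {..<n} (\<lambda>_. \<nu>)) borel (\<lambda>x. \<Sum>i<n. x i)) u = char \<nu> u ^ n"
proof -
  interpret \<nu>: real_distribution \<nu> by fact
  interpret P: prob_space "Pi\<^sub>M {..<n} (\<lambda>_. \<nu>)"
    by (intro prob_space_PiM) unfold_locales
  have comp: "distr (Pi\<^sub>M {..<n} (\<lambda>_. \<nu>)) borel (\<lambda>x. x i) = \<nu>" if "i < n" for i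
    using distr_PiM_component[of "{..<n}" "\<lambda>_. \<nu>" i] that \<nu>.prob_space_axioms
    by (simp cong: distr_cong)
  \<comment> \<open>The joint law of the coordinates is the product measure itself, since
    restriction is the identity on its space. This is the product criterion for independence,
    applied to a nonempty index set.\<close>
  have "distr (Pi\<^sub>M {..<n} (\<lambda>_. \<nu>)) (Pi\<^sub>M {..<n} (\<lambda>_. borel)) (\<lambda>x. \<lambda>i\<in>{..<n}. x i)
      = distr (Pi\<^sub>M {..<n} (\<lambda>_. \<nu>)) (Pi\<^sub>M {..<n} (\<lambda>_. \<nu>)) (\<lambda>x. x)"
    by (intro distr_cong sets_PiM_cong) (auto simp: space_PiM PiE_restrict)
  also have "\<dots> = Pi\<^sub>M {..<n} (\<lambda>i. distr (Pi\<^sub>M {..<n} (\<lambda>_. \<nu>)) borel (\<lambda>x. x i))"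
    unfolding distr_id2[OF refl] by (intro PiM_cong) (auto simp: comp)
  finally have "P.indep_vars (\<lambda>_. borel) (\<lambda>i x. x i) {..<n}"
    using \<open>n \<ge> 1\<close> by (subst P.indep_vars_iff_distr_eq_PiM') (auto simp: lessThan_empty_iff)
  then show ?thesis
    by (subst P.char_distr_sum) (simp_all add: comp)
qed

text \<open>The IDT identity is taken at the single time \<open>t\<close>; projecting the one-point
  finite-dimensional law to its coordinate gives a law on the reals.\<close>

lemma IDT_marginal_convolution_power:
  assumes "IDT_process M X" "t \<ge> 0" "n \<ge> 1"
  shows "distr M borel (X (real n * t))
       = distr (Pi\<^sub>M {..<n} (\<lambda>_. distr M borel (X t))) borel (\<lambda>x. \<Sum>i<n. x i)"
proof -
  have M: "prob_space M" and meas: "\<And>s. s \<ge> 0 \<Longrightarrow> X s \<in> borel_measurable M"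
    using assms(1) by (auto simp: IDT_process_def real_process_def)
  have [measurable]: "X t \<in> borel_measurable M" "X (real n * t) \<in> borel_measurable M"
    using meas assms(2) by auto
  have "fin_dim_distr M (\<lambda>t \<omega>. X (real n * t) \<omega>) {t}
      = fin_dim_distr (Pi\<^sub>M {..<n} (\<lambda>_. M)) (\<lambda>t \<omega>. \<Sum>i<n. X t (\<omega> i)) {t}"
    using assms by (simp add: IDT_process_def eq_in_law_def)
  then have "distr (fin_dim_distr M (\<lambda>t \<omega>. X (real n * t) \<omega>) {t}) borel (\<lambda>x. x t)
      = distr (fin_dim_distr (Pi\<^sub>M {..<n} (\<lambda>_. M)) (\<lambda>t \<omega>. \<Sum>i<n. X t (\<omega> i)) {t})
          borel (\<lambda>x. x t)"
    by simp
  moreover have "(\<lambda>\<omega>. \<lambda>s\<in>{t}. X (real n * s) \<omega>) \<in> measurable M (Pi\<^sub>M {t} (\<lambda>_. borel))"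
    by (rule measurable_restrict) auto
  moreover have "(\<lambda>\<omega>. \<lambda>s\<in>{t}. \<Sum>i<n. X s (\<omega> i))
      \<in> measurable (Pi\<^sub>M {..<n} (\<lambda>_. M)) (Pi\<^sub>M {t} (\<lambda>_. borel))"
    by (rule measurable_restrict) auto
  ultimately show ?thesis
    using distr_PiM_sum[OF M, of "X t" n]
    by (simp add: fin_dim_distr_def distr_distr comp_def)
qed

text \<open>Over the grid 0, \<open>t\<close>, ..., \<open>n t\<close> the value at time
  \<open>n t\<close> telescopes into \<open>n\<close> independent increments, each with the law of
  \<open>Y t\<close>.\<close>

lemma Levy_marginal_char_power:
  assumes "Levy_process N Y" "t \<ge> 0"
  shows "char (distr N borel (Y (real n * t))) u = char (distr N borel (Y t)) u ^ n"
proof -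
  have proc: "real_process N Y" and zero: "AE \<omega> in N. Y 0 \<omega> = 0"
    and inc: "independent_increments N Y" and stat: "stationary_increments N Y"
    using assms(1) by (auto simp: Levy_process_def)
  interpret prob_space N
    using proc by (simp add: real_process_def)
  have meas: "Y s \<in> borel_measurable N" if "s \<ge> 0" for s
    using proc that by (simp add: real_process_def)
  have from_zero: "distr N borel (\<lambda>\<omega>. Y s \<omega> - Y 0 \<omega>) = distr N borel (Y s)" if "s \<ge> 0" for s
    using zero meas[OF that] meas[of 0] by (intro distr_cong_AE) auto
  show ?thesis
  \<comment> \<open>The grid is strictly increasing, as \<open>independent_increments\<close>
    demands, only for \<open>t > 0\<close>. At time 0 the law is the point mass at 0.\<close>
  proof (cases "t = 0")
    case True
    have "distr N borel (Y 0) = distr N borel (\<lambda>_. 0)"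
      using zero meas[of 0] by (intro distr_cong_AE) auto
    then show ?thesis
      using True by (simp add: char_def integral_return)
  next
    case False
    define D where "D = (\<lambda>i \<omega>. Y (real (Suc i) * t) \<omega> - Y (real i * t) \<omega>)"
    have "indep_vars (\<lambda>_. borel) D {..<n}"
      using inc[unfolded independent_increments_def, rule_format, of "\<lambda>i. real i * t" n]
        False assms(2) by (simp add: D_def)
    moreover have "distr N borel (D i) = distr N borel (Y t)" for i
      using stat[unfolded stationary_increments_def, rule_format, of "real i * t" t]
        assms(2) from_zero by (simp add: D_def algebra_simps)
    moreover have "(\<Sum>i<n. D i \<omega>) = Y (real n * t) \<omega> - Y 0 \<omega>" for \<omega>
      unfolding D_def by (subst sum_lessThan_telescope) simp
    ultimately show ?thesis
      using char_distr_sum[of D "{..<n}" u] from_zero[of "real n * t"] assms(2) by simp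
  qed
qed

theorem proposition4p1:
  fixes M :: "'a measure" and X :: "real \<Rightarrow> 'a \<Rightarrow> real"
    and N :: "'b measure" and Y :: "real \<Rightarrow> 'b \<Rightarrow> real"
  assumes "IDT_process M X"
    and "right_continuous_paths M X"
    and "Levy_process N Y"
    and "distr M borel (X 1) = distr N borel (Y 1)"
  shows "infinitely_divisible (distr M borel (X 1)) \<and>
         (\<forall>t\<ge>0. distr M borel (X t) = distr N borel (Y t))"
proof (intro conjI allI impI)
  have procX: "real_process M X" and procY: "real_process N Y"
    using assms by (auto simp: IDT_process_def Levy_process_def)
  have rdX: "real_distribution (distr M borel (X t))" if "t \<ge> 0" for t
    using procX that by (auto simp: real_process_def intro: prob_space.real_distribution_distr)
  have rdY: "real_distribution (distr N borel (Y t))" if "t \<ge> 0" for t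
    using procY that by (auto simp: real_process_def intro: prob_space.real_distribution_distr)
  \<comment> \<open>The \<open>n\<close>-th convolution root of the law of \<open>X 1\<close> is the
    law of \<open>X (1 / real n)\<close>.\<close>
  have "\<exists>\<nu>. real_distribution \<nu> \<and>
      distr M borel (X 1) = distr (Pi\<^sub>M {..<n} (\<lambda>_. \<nu>)) borel (\<lambda>x. \<Sum>i<n. x i)"
    if "n \<ge> 1" for n :: nat
    using IDT_marginal_convolution_power[OF assms(1), of "1 / real n" n] that
    by (intro exI[of _ "distr M borel (X (1 / real n))"]) (simp add: rdX)
  then show "infinitely_divisible (distr M borel (X 1))"
    by (simp add: infinitely_divisible_def rdX)
  fix t :: real assume t: "t \<ge> 0"
  have "scaling_family (\<lambda>t. char (distr M borel (X t)))"
    using assms(2) procX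
    by (intro scaling_family_char_marginal)
      (auto simp: right_continuous_paths_def IDT_marginal_convolution_power[OF assms(1)]
        char_convolution_power rdX)
  moreover have "scaling_family (\<lambda>t. char (distr N borel (Y t)))"
  proof (rule scaling_family_char_marginal[OF procY])
    fix t :: real assume "t \<ge> 0"
    have "AE \<omega> in N. cadlag (\<lambda>t. Y t \<omega>)"
      using assms(3) by (simp add: Levy_process_def)
    then show "AE \<omega> in N. continuous (at_right t) (\<lambda>s. Y s \<omega>)"
      by eventually_elim (use \<open>t \<ge> 0\<close> in \<open>simp add: cadlag_def\<close>)
  qed (use Levy_marginal_char_power[OF assms(3)] in simp)
  ultimately have "char (distr M borel (X t)) = char (distr N borel (Y t))"
    using scaling_family_unique[of "\<lambda>t. char (distr M borel (X t))"
        "\<lambda>t. char (distr N borel (Y t))" t] assms(4) t by simp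
  \<comment> \<open>A distribution on the reals is determined by its characteristic
    function.\<close>
  then show "distr M borel (X t) = distr N borel (Y t)"
    using t by (intro Levy_uniqueness rdX rdY)
qed

end
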